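(* Let $B>0$ be a real constant. Then, for large $x$ (i.e. as $x\to+\infty$), $$W_{\mathcal{L}}(x)\sim W(x)-\ln\left(\ln\left(BW(x)\right)\right),$$ where $W_{\mathcal{L}}$ is the logarithmic Lambert function with constant $B$ and $W(x)$ denotes the Lambert $W$ function.
   Context: For a real constant $B\neq 0$, the logarithmic Lambert function $y=W_{\mathcal{L}}(x)$ is defined as the solution $y$ of the equation $y\ln(By)e^{y}=x$, where $y$ is real with $By>0$; for $B>0$ and $x>0$ there is exactly one such $y$. The (classical, principal) Lambert function $W(x)$, for $x>0$, is the unique $w>0$ with $we^w=x$. The notation $F(x)\sim G(x)$ as $x\to+\infty$ means $F(x)/G(x)\to 1$. *)

theory Defs
  imports Complex_Main
begin

(* Both functions are defined by description on all of real. They are meaningful only where the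
   solution exists and is unique; the two ex1 lemmas below show that this is the case for x > 0
   (and B > 0 in the second one). Elsewhere no value is claimed. *)

definition lambert_W :: "real \<Rightarrow> real" where
  "lambert_W x = (THE w. w > 0 \<and> w * exp w = x)"

definition log_lambert_W :: "real \<Rightarrow> real \<Rightarrow> real" where
  "log_lambert_W B x = (THE y. B * y > 0 \<and> y * ln (B * y) * exp y = x)"

lemma lambert_W_ex1:
  fixes x :: real
  assumes "x > 0"
  shows "\<exists>!w. w > 0 \<and> w * exp w = x"
proof -
  have mono: "v * exp v < w * exp w" if "0 < v" "v < w" for v w :: real
    using that by (intro mult_strict_mono) auto
  have "\<exists>w\<ge>0. w \<le> x \<and> w * exp w = x"
  proof (rule IVT')
    show "continuous_on {0..x} (\<lambda>w. w * exp w)"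
      by (intro continuous_intros)
    show "x \<le> x * exp x"
      using assms by simp
  qed (use assms in auto)
  then obtain w where w: "w \<ge> 0" "w * exp w = x" by blast
  with assms have "w > 0" by (cases "w = 0") auto
  with w mono show ?thesis
    by (metis linorder_neq_iff)
qed

lemma log_lambert_W_ex1:
  fixes B x :: real
  assumes "B > 0" "x > 0"
  shows "\<exists>!y. B * y > 0 \<and> y * ln (B * y) * exp y = x"
proof -
  let ?f = "\<lambda>y. y * ln (B * y) * exp y"
  have gt: "y > 1 / B" if "B * y > 0" "?f y = x" for y
  proof -
    have "y > 0" using that(1) assms by (simp add: zero_less_mult_iff)
    then have "ln (B * y) > 0"
      using that(2) assms(2) by (simp add: zero_less_mult_iff flip: that(2))
    then show ?thesis
      using that(1) assms by (simp add: field_simps)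
  qed
  have mono: "?f y < ?f z" if "1 / B < y" "y < z" for y z
  proof -
    have y: "y > 0" using that assms by (meson less_trans zero_less_divide_1_iff)
    have "1 < B * y" "B * y < B * z"
      using that assms by (auto simp: field_simps)
    then have "0 < ln (B * y)" "ln (B * y) < ln (B * z)" by auto
    with y that show ?thesis
      by (intro mult_strict_mono) (auto intro!: mult_pos_pos)
  qed
  define b where "b = max (exp 1 / B) x"
  have b: "b \<ge> exp 1 / B" "b \<ge> x" by (auto simp: b_def)
  have b0: "b > 0" using b assms by linarith
  have Bb: "exp 1 \<le> B * b" using b(1) assms by (simp add: field_simps)
  have "\<exists>y\<ge>1 / B. y \<le> b \<and> ?f y = x"
  proof (rule IVT')
    show "?f (1 / B) \<le> x" using assms by simp
    have "ln (exp 1) \<le> ln (B * b)"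
      using Bb b0 assms by (subst ln_le_cancel_iff) auto
    then have "1 \<le> ln (B * b)" by simp
    then have "b * 1 * 1 \<le> ?f b"
      using b0 by (intro mult_mono) auto
    with b(2) show "x \<le> ?f b" by simp
    have "1 / B \<le> exp 1 / B" using assms by (simp add: divide_right_mono)
    with b(1) show "1 / B \<le> b" by linarith
    show "continuous_on {1 / B..b} ?f"
    proof (intro continuous_intros ballI)
      fix y assume "y \<in> {1 / B..b}"
      then have "y > 0" using assms by (auto intro: less_le_trans[of 0 "1 / B"])
      then show "B * y \<noteq> 0" using assms by simp
    qed
  qed
  then obtain y where y: "y \<ge> 1 / B" "?f y = x" by blast
  have "y > 0" using y(1) assms by (meson less_le_trans zero_less_divide_1_iff)
  then have "B * y > 0" using assms by simp
  with y(2) gt mono show ?thesis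
    by (metis linorder_neq_iff)
qed

end

theory Submission
  imports Defs "HOL-Real_Asymp.Real_Asymp"
begin

text \<open>
  Write \<open>w = W(x)\<close>, \<open>y = W\<^sub>L(x)\<close> and \<open>L = ln (B w)\<close>, so that \<open>y ln (B y) e\<^sup>y = w e\<^sup>w\<close>. As soon as
  \<open>L \<ge> 1\<close>, the extra logarithmic factor can only make the solution smaller, so \<open>y \<le> w\<close>. Putting this
  bound back into the factor \<open>y ln (B y)\<close>, which is then at most \<open>w L\<close>, gives \<open>e\<^sup>w \<le> L e\<^sup>y\<close>, that is
  \<open>w - ln L \<le> y\<close>. Dividing the two bounds by \<open>w - ln L\<close> traps the quotient in question between \<open>1\<close>
  and \<open>w / (w - ln (ln (B w)))\<close>. The latter is an elementary function of \<open>w\<close> that tends to \<open>1\<close>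
  as \<open>w \<rightarrow> \<infinity>\<close>, and \<open>W(x) \<rightarrow> \<infinity>\<close> as \<open>x \<rightarrow> \<infinity>\<close>.
\<close>

lemma lambert_W_solves:
  assumes "x > 0"
  shows "lambert_W x > 0" "lambert_W x * exp (lambert_W x) = x"
  using theI'[OF lambert_W_ex1[OF assms]] by (simp_all add: lambert_W_def)

lemma log_lambert_W_solves:
  assumes "B > 0" "x > 0"
  shows "log_lambert_W B x > 0"
    and "log_lambert_W B x * ln (B * log_lambert_W B x) * exp (log_lambert_W B x) = x"
  using theI'[OF log_lambert_W_ex1[OF assms]] \<open>B > 0\<close>
  by (simp_all add: log_lambert_W_def zero_less_mult_iff)

lemma filterlim_lambert_W_at_top: "filterlim lambert_W at_top at_top"
  unfolding filterlim_at_top_gt[where c = 0]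
proof (intro allI impI)
  fix c :: real
  assume "c > 0"
  show "eventually (\<lambda>x. c \<le> lambert_W x) at_top"
    using eventually_ge_at_top[of "c * exp c"]
  proof eventually_elim
    case (elim x)
    have "x > 0" using \<open>c > 0\<close> elim by (meson less_le_trans mult_pos_pos exp_gt_zero)
    note w = lambert_W_solves[OF this]
    show ?case
    proof (rule ccontr)
      assume "\<not> c \<le> lambert_W x"
      then have "lambert_W x * exp (lambert_W x) < c * exp c"
        using w(1) by (intro mult_strict_mono) auto
      with w(2) elim show False by simp
    qed
  qed
qed

text \<open>
  Both bounds compare the factors of the two sides of the equation one by one; the upper bound on
  \<open>y\<close> is what makes the comparison for the lower bound possible.
\<close>
lemma log_lambert_bounds:
  fixes B w y :: real
  assumes "B > 0" "w > 0" "y > 0" and L: "ln (B * w) \<ge> 1"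
    and eq: "y * ln (B * y) * exp y = w * exp w"
  shows "y \<le> w" and "w - ln (ln (B * w)) \<le> y"
proof -
  show "y \<le> w"
  proof (rule ccontr)
    assume "\<not> y \<le> w"
    then have "w < y" by simp
    then have "ln (B * w) \<le> ln (B * y)" using assms by simp
    with L have "ln (B * y) \<ge> 1" by simp
    then have "y * 1 * exp y \<le> y * ln (B * y) * exp y"
      using \<open>y > 0\<close> by (intro mult_mono) auto
    moreover have "w * exp w < y * exp y"
      using \<open>w < y\<close> \<open>w > 0\<close> by (intro mult_strict_mono) auto
    ultimately show False using eq by simp
  qed
  then have "ln (B * y) \<le> ln (B * w)" using assms by simp
  with \<open>y \<le> w\<close> have "y * ln (B * y) \<le> w * ln (B * w)"
    using assms by (meson L mult_left_mono mult_right_mono order_trans less_imp_le zero_le_one)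
  then have "w * exp w \<le> w * ln (B * w) * exp y"
    unfolding eq[symmetric] by (intro mult_right_mono) auto
  then have "exp w \<le> ln (B * w) * exp y" using \<open>w > 0\<close> by (simp add: mult.assoc)
  also have "\<dots> = exp (ln (ln (B * w)) + y)" using L by (simp add: exp_add)
  finally show "w - ln (ln (B * w)) \<le> y" by simp
qed

theorem theorem2p5:
  fixes B :: real
  assumes "B > 0"
  shows "((\<lambda>x. log_lambert_W B x / (lambert_W x - ln (ln (B * lambert_W x)))) \<longlongrightarrow> 1) at_top"
proof (rule tendsto_sandwich)
  have "eventually (\<lambda>w. ln (B * w) \<ge> 1 \<and> w - ln (ln (B * w)) > 0) at_top"
    by (intro eventually_conj; use \<open>B > 0\<close> in real_asymp)
  from eventually_compose_filterlim[OF this filterlim_lambert_W_at_top]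
  have *: "eventually (\<lambda>x. ln (B * lambert_W x) \<ge> 1 \<and>
             lambert_W x - ln (ln (B * lambert_W x)) > 0 \<and> x > 0) at_top"
    using eventually_gt_at_top[of 0] by eventually_elim auto
  have bounds: "log_lambert_W B x \<le> lambert_W x"
      "lambert_W x - ln (ln (B * lambert_W x)) \<le> log_lambert_W B x"
    if "x > 0" "ln (B * lambert_W x) \<ge> 1" for x
    using log_lambert_bounds[of B "lambert_W x" "log_lambert_W B x"] that \<open>B > 0\<close>
      lambert_W_solves[of x] log_lambert_W_solves[of B x] by simp_all
  show "eventually (\<lambda>x. 1 \<le> log_lambert_W B x /
          (lambert_W x - ln (ln (B * lambert_W x)))) at_top"
    using * by eventually_elim (use bounds in \<open>simp add: le_divide_eq\<close>)
  show "eventually (\<lambda>x. log_lambert_W B x / (lambert_W x - ln (ln (B * lambert_W x))) \<le>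
          lambert_W x / (lambert_W x - ln (ln (B * lambert_W x)))) at_top"
    using * by eventually_elim (use bounds in \<open>simp add: divide_right_mono\<close>)
  have "((\<lambda>w. w / (w - ln (ln (B * w)))) \<longlongrightarrow> 1) at_top"
    using \<open>B > 0\<close> by real_asymp
  from filterlim_compose[OF this filterlim_lambert_W_at_top]
  show "((\<lambda>x. lambert_W x / (lambert_W x - ln (ln (B * lambert_W x)))) \<longlongrightarrow> 1) at_top" .
qed simp

end
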